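(* Let $\mathrm{RSOC}_3 = \{(x,y,z)\in\mathbb{R}^3 : 2xy \ge z^2,\ x\ge 0,\ y\ge 0\}$. There is no polyhedral outer approximation $P \supset \mathrm{RSOC}_3$ in $\mathbb{R}^3$ such that the linear optimization problem $$\min\ z \quad \text{s.t.}\quad x = 0,\ (x,y,z)\in P$$ is bounded (i.e., such that its objective $z$ is bounded below on its feasible set).
   Context: A set $P$ is a polyhedral outer approximation of a convex set $X\subseteq\mathbb{R}^n$ if $P$ is a polyhedron (an intersection of a finite number of closed half-spaces, i.e., linear inequalities of the form $a_i^T x\le b_i$) and $X\subseteq P$. The problem in the claim is a relaxation of the problem $\min\{z : x=0,\ (x,y,z)\in \mathrm{RSOC}_3\}$. *)

theory Defs
  imports "HOL-Analysis.Analysis"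
begin

text \<open>Components 1, 2, 3 of a vector are the coordinates x, y, z.\<close>

definition RSOC3 :: "(real ^ 3) set" where
  "RSOC3 = {v. 2 * v $ 1 * v $ 2 \<ge> (v $ 3)\<^sup>2 \<and> v $ 1 \<ge> 0 \<and> v $ 2 \<ge> 0}"

text \<open>The notion is meant for convex \<open>X\<close>; convexity is not part of the predicate.\<close>

definition polyhedral_outer_approximation :: "(real ^ 'n) set \<Rightarrow> (real ^ 'n) set \<Rightarrow> bool" where
  "polyhedral_outer_approximation P X \<longleftrightarrow> polyhedron P \<and> X \<subseteq> P"

end

theory Submission
  imports Defs
begin

text \<open>For fixed \<open>z\<close>, the points \<open>(z\<^sup>2/(2y), y, z)\<close> of the cone approach the points \<open>(0, y, z)\<close> as
  \<open>y \<rightarrow> \<infinity>\<close>. A half-space containing the cone therefore contains \<open>(0, y, z)\<close> for all large \<open>y\<close>: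
  either its boundary is parallel to the \<open>y\<close>-axis, and the limit decides, or moving along the
  \<open>y\<close>-axis leads arbitrarily deep into it. Finitely many half-spaces share such a \<open>y\<close>, so \<open>z\<close> takes
  every real value on the feasible set.\<close>

lemma eventually_in_halfspace:
  fixes a :: "real ^ 3"
  assumes sub: "RSOC3 \<subseteq> {v. a \<bullet> v \<le> b}"
  shows "\<forall>\<^sub>F y in at_top. (vector [0, y, z] :: real ^ 3) \<in> {v. a \<bullet> v \<le> b}"
proof -
  \<comment> \<open>These points lie on the boundary of the cone, where
    \<open>2xy = z\<^sup>2\<close>. The third coordinate \<open>w\<close> stays free because both
    \<open>0\<close> and \<open>z\<close> are used for it.\<close>
  have ineq: "a $ 1 * (w\<^sup>2 / (2 * y)) + a $ 2 * y + a $ 3 * w \<le> b" if "y > 0" for w y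
  proof -
    have "(vector [w\<^sup>2 / (2 * y), y, w] :: real ^ 3) \<in> RSOC3"
      using that by (simp add: RSOC3_def)
    then show ?thesis
      using sub by (auto simp: inner_vec_def sum_3)
  qed
  have "a $ 2 \<le> 0"
  proof (rule ccontr)
    assume "\<not> a $ 2 \<le> 0"
    \<comment> \<open>On the \<open>y\<close>-axis (\<open>w = 0\<close>), this choice of
      \<open>y\<close> makes the left side equal to \<open>\<bar>b\<bar> + 1\<close>, which exceeds
      \<open>b\<close>.\<close>
    then show False
      using ineq[of "(\<bar>b\<bar> + 1) / a $ 2" 0] by simp
  qed
  then have "\<forall>\<^sub>F y in at_top. a $ 2 * y + a $ 3 * z \<le> b"
  proof (cases "a $ 2 = 0")
    case True
    have "((\<lambda>y. a $ 1 * (z\<^sup>2 / (2 * y)) + a $ 3 * z) \<longlongrightarrow> a $ 1 * 0 + a $ 3 * z) at_top"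
      by (intro tendsto_intros real_tendsto_divide_at_top
          filterlim_tendsto_pos_mult_at_top[OF tendsto_const] filterlim_ident) auto
    moreover have "\<forall>\<^sub>F y in at_top. a $ 1 * (z\<^sup>2 / (2 * y)) + a $ 3 * z \<le> b"
      using eventually_gt_at_top[of 0] by eventually_elim (use ineq True in force)
    ultimately have "a $ 1 * 0 + a $ 3 * z \<le> b"
      by (rule tendsto_upperbound) simp
    then show ?thesis
      using True by simp
  next
    case False
    with \<open>a $ 2 \<le> 0\<close> have "a $ 2 < 0" by simp
    show ?thesis
      \<comment> \<open>At this threshold \<open>a $ 2 * y + a $ 3 * z\<close> equals
        \<open>b\<close>; beyond it the sum only decreases.\<close>
      using eventually_ge_at_top[of "(b - a $ 3 * z) / a $ 2"]
      by eventually_elim (use \<open>a $ 2 < 0\<close> in \<open>simp add: field_simps\<close>)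
  qed
  then show ?thesis
    by (simp add: inner_vec_def sum_3)
qed

lemma eventually_in_polyhedron:
  fixes P :: "(real ^ 3) set"
  assumes "polyhedron P" and "RSOC3 \<subseteq> P"
  shows "\<forall>\<^sub>F y in at_top. (vector [0, y, z] :: real ^ 3) \<in> P"
proof -
  obtain F where "finite F" and P: "P = \<Inter>F"
    and F: "\<And>h. h \<in> F \<Longrightarrow> \<exists>a b. a \<noteq> 0 \<and> h = {v. a \<bullet> v \<le> b}"
    using \<open>polyhedron P\<close> unfolding polyhedron_def by blast
  have "\<forall>\<^sub>F y in at_top. (vector [0, y, z] :: real ^ 3) \<in> h" if "h \<in> F" for h
  proof -
    obtain a b where "h = {v. a \<bullet> v \<le> b}"
      using F[OF \<open>h \<in> F\<close>] by blast
    moreover have "RSOC3 \<subseteq> h"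
      using \<open>RSOC3 \<subseteq> P\<close> P that by blast
    ultimately show ?thesis
      using eventually_in_halfspace by blast
  qed
  then have "\<forall>\<^sub>F y in at_top. \<forall>h\<in>F. (vector [0, y, z] :: real ^ 3) \<in> h"
    using \<open>finite F\<close> by (intro eventually_ball_finite) auto
  then show ?thesis
    by (simp add: P)
qed

theorem lemma3:
  shows "\<not> (\<exists>P :: (real ^ 3) set. polyhedral_outer_approximation P RSOC3 \<and>
    bdd_below ((\<lambda>v. v $ 3) ` {v. v $ 1 = 0 \<and> v \<in> P}))"
proof (intro notI, elim exE conjE)
  fix P :: "(real ^ 3) set"
  assume outer: "polyhedral_outer_approximation P RSOC3"
    and "bdd_below ((\<lambda>v. v $ 3) ` {v. v $ 1 = 0 \<and> v \<in> P})"
  then obtain m where m: "\<And>v. v $ 1 = 0 \<Longrightarrow> v \<in> P \<Longrightarrow> m \<le> v $ 3"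
    unfolding bdd_below_def by auto
  \<comment> \<open>The value \<open>m - 1\<close> lies just below the supposed lower bound
    \<open>m\<close>, so a single feasible point at this height refutes it.\<close>
  have "\<forall>\<^sub>F y in at_top. (vector [0, y, m - 1] :: real ^ 3) \<in> P"
    using outer eventually_in_polyhedron by (auto simp: polyhedral_outer_approximation_def)
  then obtain y where "(vector [0, y, m - 1] :: real ^ 3) \<in> P"
    using eventually_happens trivial_limit_at_top_linorder by blast
  then show False
    using m[of "vector [0, y, m - 1]"] by simp
qed

end
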